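(* For every integer $k\ge 4$, $T_k(k+4)=k+7$, and the complete bipartite graph $K_{3,k+3}$ is an extremal graph, i.e. a triangle-free graph on $k+6$ vertices containing no $k$-sparse set of $k+4$ vertices.
   Context: All graphs are finite and simple. A set $S$ of vertices of a graph $G$ is $k$-sparse if the induced subgraph $G[S]$ has maximum degree at most $k$. For integers $k\ge0$ and $j\ge1$, $T_k(j)$ denotes the minimum $n$ such that every triangle-free graph on $n$ vertices contains a $k$-sparse set of $j$ vertices. An extremal graph for $T_k(j)$ is a triangle-free graph on $T_k(j)-1$ vertices containing no $k$-sparse set of $j$ vertices. *)

theory Defs
  imports "Graph_Theory.Kuratowski"
begin

text \<open>
  Finite simple graphs are the symmetric, loop-free digraphs without parallel arcs of the
  locale \<^locale>\<open>graph\<close>. Each edge is represented by two opposite arcs, so the degree of a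
  vertex is its out-degree.
\<close>

definition k_sparse :: "nat \<Rightarrow> ('a, 'b) pre_digraph \<Rightarrow> 'a set \<Rightarrow> bool" where
  "k_sparse k G S \<longleftrightarrow> S \<subseteq> verts G \<and> (\<forall>v\<in>S. out_degree (G \<restriction> S) v \<le> k)"

text \<open>In a loop-free graph the three vertices below are automatically distinct.\<close>

definition triangle_free :: "('a, 'b) pre_digraph \<Rightarrow> bool" where
  "triangle_free G \<longleftrightarrow> \<not> (\<exists>u v w. u \<rightarrow>\<^bsub>G\<^esub> v \<and> v \<rightarrow>\<^bsub>G\<^esub> w \<and> w \<rightarrow>\<^bsub>G\<^esub> u)"

definition has_sparse_set :: "nat \<Rightarrow> nat \<Rightarrow> ('a, 'b) pre_digraph \<Rightarrow> bool" where
  "has_sparse_set k j G \<longleftrightarrow> (\<exists>S. k_sparse k G S \<and> card S = j)"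

text \<open>
  The number \<open>T\<^sub>k(j)\<close>, for \<open>j \<ge> 1\<close>. Every finite simple graph is isomorphic to one whose vertices
  are natural numbers and whose arcs are pairs of vertices, so it suffices to let \<open>G\<close> range over
  these. If no suitable \<open>n\<close> existed, the infimum would be \<open>0\<close>; hence a positive value is an
  attained minimum.
\<close>

definition T_num :: "nat \<Rightarrow> nat \<Rightarrow> nat" where
  "T_num k j = Inf {n. \<forall>G :: nat pair_pre_digraph.
     graph (with_proj G) \<and> triangle_free (with_proj G) \<and> card (verts (with_proj G)) = n
       \<longrightarrow> has_sparse_set k j (with_proj G)}"

definition extremal_graph :: "nat \<Rightarrow> nat \<Rightarrow> ('a, 'b) pre_digraph \<Rightarrow> bool" where
  "extremal_graph k j G \<longleftrightarrow> graph G \<and> triangle_free G \<and> card (verts G) + 1 = T_num k j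
     \<and> \<not> has_sparse_set k j G"

text \<open>
  The library's \<open>K\<^bsub>m,n\<^esub> G\<close> says that \<open>G\<close> is a complete bipartite graph with parts of sizes
  \<open>m\<close> and \<open>n\<close>. Such graphs exist:
\<close>

lemma complete_bipartite_exists: "\<exists>G :: nat pair_pre_digraph. K\<^bsub>m,n\<^esub> (with_proj G)"
proof -
  let ?U = "{..<m}" and ?V = "{m..<m + n}"
  let ?G = "\<lparr>pverts = ?U \<union> ?V, parcs = ?U \<times> ?V \<union> ?V \<times> ?U\<rparr>"
  have "?U \<inter> ?V = {}" "card ?U = m" "card ?V = n" by auto
  then have "K\<^bsub>m,n\<^esub> (with_proj ?G)"
    unfolding complete_bipartite_digraph_pair_def
    by (intro conjI exI[of _ ?U] exI[of _ ?V]) simp_all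
  then show ?thesis by blast
qed

end

theory Submission
  imports Defs
begin

text \<open>
  For the upper bound, suppose that some vertex \<open>v\<close> of a triangle-free graph on \<open>k + 7\<close> vertices
  has more than \<open>k\<close> neighbours. Its neighbourhood \<open>N\<close> is independent, so we may assume
  \<open>|N| = k + 4 - t\<close> with \<open>1 \<le> t \<le> 3\<close>, which leaves a set \<open>W\<close> of \<open>t + 2\<close> further vertices. Let
  \<open>M\<close> consist of those \<open>x \<in> W\<close> that have at least \<open>k + 2 - t\<close> neighbours in \<open>N\<close>. Two such vertices
  have a common neighbour in \<open>N\<close> because \<open>t < k\<close>, so \<open>M\<close> is independent. If \<open>|M| \<le> 2\<close>, then adding
  \<open>t\<close> vertices of \<open>W - M\<close> to \<open>N\<close> gives a \<open>k\<close>-sparse set. Otherwise \<open>v\<close> and three vertices of \<open>M\<close>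
  form an independent set, whose union with \<open>k\<close> vertices of \<open>N\<close> is \<open>k\<close>-sparse.
\<close>

text \<open>Without parallel arcs, \<open>head G\<close> is injective on the arcs leaving
  \<open>x\<close>, so counting arcs amounts to counting neighbours. Sparsity can then be treated
  through adjacency alone.\<close>

lemma (in graph) out_degree_induce_subgraph:
  "x \<in> S \<Longrightarrow> out_degree (G \<restriction> S) x = card {y \<in> S. x \<rightarrow>\<^bsub>G\<^esub> y}"
proof -
  assume "x \<in> S"
  then have "head G ` out_arcs (G \<restriction> S) x = {y \<in> S. x \<rightarrow>\<^bsub>G\<^esub> y}"
    by (auto simp: out_arcs_def arcs_ends_conv)
  moreover have "inj_on (head G) (out_arcs (G \<restriction> S) x)"
    by (rule inj_onI) (auto simp: out_arcs_def arc_to_ends_def intro: no_multi_arcs)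
  ultimately show ?thesis
    unfolding out_degree_def by (metis card_image)
qed

lemma (in graph) k_sparse_iff:
  "k_sparse k G S \<longleftrightarrow> S \<subseteq> verts G \<and> (\<forall>x\<in>S. card {y \<in> S. x \<rightarrow>\<^bsub>G\<^esub> y} \<le> k)"
  by (auto simp: k_sparse_def out_degree_induce_subgraph)

definition independent :: "('a, 'b) pre_digraph \<Rightarrow> 'a set \<Rightarrow> bool" where
  "independent G A \<longleftrightarrow> (\<forall>x\<in>A. \<forall>y\<in>A. \<not> x \<rightarrow>\<^bsub>G\<^esub> y)"

lemma independent_subset: "independent G B \<Longrightarrow> A \<subseteq> B \<Longrightarrow> independent G A"
  by (auto simp: independent_def)

text \<open>Inside the union, a vertex of either set has all its neighbours in the other set, which
  has at most \<open>k\<close> elements.\<close>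

lemma (in graph) k_sparse_union_independent:
  assumes "A \<subseteq> verts G" "B \<subseteq> verts G" "independent G A" "independent G B"
    and "card A \<le> k" "card B \<le> k"
  shows "k_sparse k G (A \<union> B)"
  unfolding k_sparse_iff
proof (intro conjI ballI)
  fix x assume x: "x \<in> A \<union> B"
  have fin: "finite A" "finite B"
    using assms finite_subset[OF _ finite_verts] by auto
  show "card {y \<in> A \<union> B. x \<rightarrow>\<^bsub>G\<^esub> y} \<le> k"
  proof (cases "x \<in> A")
    case True
    then have "{y \<in> A \<union> B. x \<rightarrow>\<^bsub>G\<^esub> y} \<subseteq> B"
      using assms(3) by (auto simp: independent_def)
    then show ?thesis using card_mono[OF fin(2)] assms(6) le_trans by blast
  next
    case False
    then have "{y \<in> A \<union> B. x \<rightarrow>\<^bsub>G\<^esub> y} \<subseteq> A"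
      using assms(4) x by (auto simp: independent_def)
    then show ?thesis using card_mono[OF fin(1)] assms(5) le_trans by blast
  qed
qed (use assms in auto)

lemma (in graph) dominates_sym: "x \<rightarrow>\<^bsub>G\<^esub> y \<Longrightarrow> y \<rightarrow>\<^bsub>G\<^esub> x"
  by (rule arcs_ends_symmetric[OF sym_arcs])

lemma (in graph) not_dominates_refl: "\<not> x \<rightarrow>\<^bsub>G\<^esub> x"
  using no_loops by (auto simp: arcs_ends_conv)

lemma (in graph) has_sparse_set_of_large_degree:
  assumes tf: "triangle_free G" and card_G: "card (verts G) = k + 7" and k: "k \<ge> 4"
    and v: "v \<in> verts G" and deg: "card {y \<in> verts G. v \<rightarrow>\<^bsub>G\<^esub> y} > k"
  shows "has_sparse_set k (k + 4) G"
proof -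
  define N where "N = {y \<in> verts G. v \<rightarrow>\<^bsub>G\<^esub> y}"
  have no_tri: "\<not> (x \<rightarrow>\<^bsub>G\<^esub> y \<and> y \<rightarrow>\<^bsub>G\<^esub> z \<and> x \<rightarrow>\<^bsub>G\<^esub> z)" for x y z
    using tf dominates_sym unfolding triangle_free_def by blast
  have N: "N \<subseteq> verts G" "finite N" "v \<notin> N" "independent G N" "card N > k"
    using no_tri not_dominates_refl deg by (auto simp: N_def independent_def)
  show ?thesis
  proof (cases "card N \<ge> k + 4")
    case True
    then obtain S where S: "S \<subseteq> N" "card S = k + 4"
      using obtain_subset_with_card_n by metis
    then have "{y \<in> S. x \<rightarrow>\<^bsub>G\<^esub> y} = {}" if "x \<in> S" for x
      using N(4) that by (auto simp: independent_def)
    then have "k_sparse k G S"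
      using S N(1) unfolding k_sparse_iff by (metis card.empty le0 order_trans)
    then show ?thesis using S(2) by (auto simp: has_sparse_set_def)
  next
    case False
    define t where "t = k + 4 - card N"
    have t: "card N + t = k + 4" "1 \<le> t" "t \<le> 3"
      using False N(5) by (auto simp: t_def)
    define W where "W = verts G - insert v N"
    have fin_W: "finite W" by (simp add: W_def)
    have card_W: "card W = t + 2"
    proof -
      have "card W = k + 7 - card (insert v N)"
        unfolding W_def using N v card_G by (subst card_Diff_subset) auto
      then show ?thesis using N t by simp
    qed
    define d where "d x = card {y \<in> N. x \<rightarrow>\<^bsub>G\<^esub> y}" for x
    \<comment> \<open>The threshold is chosen so that \<open>x\<close> in \<open>W - M\<close> has
      \<open>d x + (t - 1) \<le> k\<close>: it can be added to \<open>N\<close> together with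
      \<open>t - 1\<close> other vertices, even if it is adjacent to all of them.\<close>
    define M where "M = {x \<in> W. d x + t \<ge> k + 2}"
    have fin_M: "finite M" using fin_W by (simp add: M_def)
    have "independent G M"
      unfolding independent_def
    proof (intro ballI notI)
      fix x y assume xy: "x \<in> M" "y \<in> M" "x \<rightarrow>\<^bsub>G\<^esub> y"
      \<comment> \<open>Adjacent vertices have disjoint neighbourhoods, so
        \<open>d x + d y \<le> k + 4 - t\<close>. Membership in \<open>M\<close> gives
        \<open>d x + d y \<ge> 2 * (k + 2 - t)\<close>, hence \<open>k \<le> t \<le> 3\<close>,
        against \<open>k \<ge> 4\<close>.\<close>
      have "d x + d y = card ({z \<in> N. x \<rightarrow>\<^bsub>G\<^esub> z} \<union> {z \<in> N. y \<rightarrow>\<^bsub>G\<^esub> z})"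
        unfolding d_def using N(2) no_tri xy(3)
        by (subst card_Un_disjoint) auto
      also have "\<dots> \<le> card N" by (rule card_mono) (use N(2) in auto)
      finally show False using xy t k by (auto simp: M_def)
    qed
    show ?thesis
    proof (cases "card M \<ge> 3")
      case True
      then obtain A where A: "A \<subseteq> M" "card A = 3"
        using obtain_subset_with_card_n by metis
      obtain B where B: "B \<subseteq> N" "card B = k"
        using N(5) obtain_subset_with_card_n less_imp_le by metis
      have fin: "finite A" "finite B"
        using A B fin_M N(2) finite_subset by auto
      have A': "v \<notin> A" "A \<inter> N = {}" "A \<subseteq> verts G"
        using A by (auto simp: M_def W_def)
      have v_A: "\<not> v \<rightarrow>\<^bsub>G\<^esub> x" if "x \<in> A" for x
        using that A' by (auto simp: N_def)
      have "independent G (insert v A)"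
        using independent_subset[OF \<open>independent G M\<close> A(1)] v_A dominates_sym not_dominates_refl
        unfolding independent_def by blast
      \<comment> \<open>The set \<open>insert v A\<close> has four elements, so the size bound for
        it is exactly \<open>k \<ge> 4\<close>.\<close>
      then have "k_sparse k G (insert v A \<union> B)"
        using A A' B N v k fin independent_subset[OF N(4) B(1)]
        by (intro k_sparse_union_independent) auto
      moreover have "card (insert v A \<union> B) = k + 4"
        using A A' B N fin by (subst card_Un_disjoint) auto
      ultimately show ?thesis by (auto simp: has_sparse_set_def)
    next
      case False
      have "M \<subseteq> W" by (auto simp: M_def)
      then have "t \<le> card (W - M)"
        using card_W False fin_M by (simp add: card_Diff_subset)
      then obtain T where T: "T \<subseteq> W - M" "card T = t"
        using obtain_subset_with_card_n by metis
      have fin: "finite T" using T fin_W finite_subset by blast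
      have disj: "N \<inter> T = {}" using T by (auto simp: W_def)
      have "card {y \<in> N \<union> T. x \<rightarrow>\<^bsub>G\<^esub> y} \<le> k" if x: "x \<in> N \<union> T" for x
      proof (cases "x \<in> N")
        case True
        then have "{y \<in> N \<union> T. x \<rightarrow>\<^bsub>G\<^esub> y} \<subseteq> T"
          using N(4) by (auto simp: independent_def)
        then have "card {y \<in> N \<union> T. x \<rightarrow>\<^bsub>G\<^esub> y} \<le> t" using card_mono[OF fin] T(2) by blast
        then show ?thesis using t k by linarith
      next
        case False
        then have "x \<in> T" using x by simp
        \<comment> \<open>Since \<open>x\<close> is not its own neighbour, \<open>T\<close>
          contributes at most \<open>t - 1\<close>; this saved unit is what the threshold in
          \<open>M\<close> relies on.\<close>
        have "{y \<in> N \<union> T. x \<rightarrow>\<^bsub>G\<^esub> y} \<subseteq> {y \<in> N. x \<rightarrow>\<^bsub>G\<^esub> y} \<union> (T - {x})"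
          using not_dominates_refl by auto
        then have "card {y \<in> N \<union> T. x \<rightarrow>\<^bsub>G\<^esub> y} \<le> card ({y \<in> N. x \<rightarrow>\<^bsub>G\<^esub> y} \<union> (T - {x}))"
          using N(2) fin by (intro card_mono) auto
        also have "\<dots> \<le> d x + card (T - {x})" unfolding d_def by (rule card_Un_le)
        also have "\<dots> = d x + (t - 1)" using \<open>x \<in> T\<close> T(2) by simp
        also have "\<dots> \<le> k" using \<open>x \<in> T\<close> T(1) t by (auto simp: M_def)
        finally show ?thesis .
      qed
      then have "k_sparse k G (N \<union> T)"
        unfolding k_sparse_iff using N(1) T(1) by (auto simp: W_def)
      moreover have "card (N \<union> T) = k + 4"
        using disj N(2) fin T(2) t by (simp add: card_Un_disjoint)
      ultimately show ?thesis by (auto simp: has_sparse_set_def)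
    qed
  qed
qed

lemma (in graph) has_sparse_set_triangle_free:
  assumes "triangle_free G" "card (verts G) = k + 7" "k \<ge> 4"
  shows "has_sparse_set k (k + 4) G"
proof (cases "\<exists>v\<in>verts G. card {y \<in> verts G. v \<rightarrow>\<^bsub>G\<^esub> y} > k")
  case True
  then show ?thesis using has_sparse_set_of_large_degree assms by blast
next
  case False
  \<comment> \<open>All degrees are at most \<open>k\<close>, so any choice of \<open>k + 4\<close>
    vertices works.\<close>
  obtain S where S: "S \<subseteq> verts G" "card S = k + 4"
    using obtain_subset_with_card_n[of "k + 4" "verts G"] assms(2) by auto
  have "card {y \<in> S. x \<rightarrow>\<^bsub>G\<^esub> y} \<le> k" if "x \<in> S" for x
  proof -
    have "card {y \<in> S. x \<rightarrow>\<^bsub>G\<^esub> y} \<le> card {y \<in> verts G. x \<rightarrow>\<^bsub>G\<^esub> y}"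
      using S(1) by (intro card_mono) auto
    then show ?thesis using False S(1) that by (meson le_trans not_le subsetD)
  qed
  then show ?thesis
    using S unfolding has_sparse_set_def k_sparse_iff by blast
qed

lemma complete_bipartite_triangle_free:
  assumes "K\<^bsub>m,n\<^esub> G"
  shows "triangle_free G"
  using assms unfolding complete_bipartite_digraph_def triangle_free_def by auto

lemma card_verts_complete_bipartite:
  assumes "K\<^bsub>m,n\<^esub> G"
  shows "card (verts G) = m + n"
proof -
  obtain U V where UV: "verts G = U \<union> V" "U \<inter> V = {}" "card U = m" "card V = n"
    and "graph G"
    using assms unfolding complete_bipartite_digraph_def by blast
  interpret graph G by fact
  have "finite U" "finite V" using UV(1) finite_verts by auto
  then show ?thesis using UV by (simp add: card_Un_disjoint)
qed

text \<open>The part sizes force any \<open>k + 4\<close> vertices to include one from the first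
  part and at least \<open>k + 1\<close> from the second, all adjacent to it. Stating the sizes as
  upper bounds also covers the smaller graphs needed for the minimality of
  \<open>k + 7\<close>.\<close>

lemma complete_bipartite_no_sparse_set:
  assumes K: "K\<^bsub>m,n\<^esub> G" and "m \<le> 3" "n \<le> k + 3"
  shows "\<not> has_sparse_set k (k + 4) G"
proof
  assume "has_sparse_set k (k + 4) G"
  then obtain S where S: "k_sparse k G S" "card S = k + 4"
    by (auto simp: has_sparse_set_def)
  obtain U V where UV: "verts G = U \<union> V" "U \<inter> V = {}" "card U = m" "card V = n"
      "arcs_ends G = U \<times> V \<union> V \<times> U"
    and "graph G"
    using K unfolding complete_bipartite_digraph_def by blast
  interpret graph G by fact
  have fin: "finite U" "finite V" using UV(1) finite_verts by auto
  have S': "S = (S \<inter> U) \<union> (S \<inter> V)" using S UV(1) by (auto simp: k_sparse_def)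
  have "card S = card (S \<inter> U) + card (S \<inter> V)"
    using fin UV(2) by (subst S', subst card_Un_disjoint) auto
  moreover have "card (S \<inter> U) \<le> 3" "card (S \<inter> V) \<le> k + 3"
    using card_mono[OF fin(1), of "S \<inter> U"] card_mono[OF fin(2), of "S \<inter> V"] UV assms by auto
  ultimately have V: "card (S \<inter> V) \<ge> k + 1" and "card (S \<inter> U) > 0"
    using S(2) by linarith+
  then obtain u where u: "u \<in> S" "u \<in> U" by (auto simp: card_gt_0_iff)
  then have "{y \<in> S. u \<rightarrow>\<^bsub>G\<^esub> y} = S \<inter> V" using UV by auto
  then have "card (S \<inter> V) \<le> k" using S(1) u unfolding k_sparse_iff by metis
  then show False using V by simp
qed

lemma T_num_k_plus_4:
  assumes "k \<ge> 4"
  shows "T_num k (k + 4) = k + 7"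
proof -
  define P where "P n \<longleftrightarrow> (\<forall>G :: nat pair_pre_digraph.
     graph (with_proj G) \<and> triangle_free (with_proj G) \<and> card (verts (with_proj G)) = n
       \<longrightarrow> has_sparse_set k (k + 4) (with_proj G))" for n
  have "P (k + 7)"
    unfolding P_def using graph.has_sparse_set_triangle_free assms by blast
  moreover have "k + 7 \<le> n" if "P n" for n
  proof (rule ccontr)
    assume "\<not> k + 7 \<le> n"
    \<comment> \<open>Minimality requires a counterexample of every order
      \<open>n \<le> k + 6\<close>, not only of order \<open>k + 6\<close>. The first part takes up
      to three vertices and the second the rest, possibly none.\<close>
    then have n: "min n 3 \<le> 3" "n - min n 3 \<le> k + 3" by auto
    obtain G :: "nat pair_pre_digraph" where G: "K\<^bsub>min n 3,n - min n 3\<^esub> (with_proj G)"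
      using complete_bipartite_exists by blast
    have "graph (with_proj G)" using G by (simp add: complete_bipartite_digraph_def)
    moreover have "card (verts (with_proj G)) = n"
      using card_verts_complete_bipartite[OF G] by simp
    ultimately show False
      using that complete_bipartite_no_sparse_set[OF G n] complete_bipartite_triangle_free[OF G]
      unfolding P_def by blast
  qed
  ultimately have "Inf {n. P n} = k + 7"
    by (intro cInf_eq_minimum) auto
  then show ?thesis unfolding T_num_def P_def .
qed

theorem theorem3p8:
  fixes k :: nat
  assumes "k \<ge> 4"
  shows "T_num k (k + 4) = k + 7 \<and>
    (\<forall>G :: ('a, 'b) pre_digraph. K\<^bsub>3,k + 3\<^esub> G \<longrightarrow>
       card (verts G) = k + 6 \<and> extremal_graph k (k + 4) G)"
proof (intro conjI allI impI)
  show T: "T_num k (k + 4) = k + 7"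
    using assms by (rule T_num_k_plus_4)
  fix G :: "('a, 'b) pre_digraph"
  assume K: "K\<^bsub>3,k + 3\<^esub> G"
  show card_G: "card (verts G) = k + 6"
    using card_verts_complete_bipartite[OF K] by simp
  have "graph G" using K by (simp add: complete_bipartite_digraph_def)
  then show "extremal_graph k (k + 4) G"
    using T card_G complete_bipartite_triangle_free[OF K] complete_bipartite_no_sparse_set[OF K]
    by (simp add: extremal_graph_def)
qed

end
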